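(* Let $N$ be a manifold of dimension $n$. Let $f$ be an injection of $N$ into an open subset $U$ of $\mathbb{R}^m$. Let $F:U\to\mathbb{R}^\ell$ be a mapping. If $\ell>2n$, then there exists a subset $\Sigma$ of $\mathcal{L}(\mathbb{R}^m,\mathbb{R}^\ell)$ with Lebesgue measure zero such that for any $\pi\in\mathcal{L}(\mathbb{R}^m,\mathbb{R}^\ell)-\Sigma$, the mapping $F_\pi\circ f:N\to\mathbb{R}^\ell$ is injective.
   Context: Conventions: $\ell,m,n$ are positive integers; all manifolds and mappings (in particular the injection $f$) are of class $C^\infty$ and all manifolds are without boundary. $\mathcal{L}(\mathbb{R}^m,\mathbb{R}^\ell)$ is the space of all linear mappings $\mathbb{R}^m\to\mathbb{R}^\ell$, identified with $(\mathbb{R}^m)^\ell$ (via matrices), which gives it Lebesgue measure. For $\pi\in\mathcal{L}(\mathbb{R}^m,\mathbb{R}^\ell)$ and $F:U\to\mathbb{R}^\ell$, $F_\pi=F+\pi|_U:U\to\mathbb{R}^\ell$. *)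

theory Defs
  imports "HOL-Analysis.Analysis"
begin

text \<open>
  Only meant for open \<open>S\<close>: derivatives are taken unrestrictedly (\<open>at x\<close>), which there is the
  same as within \<open>S\<close>. In finite dimension, a map is of class C^(k+1) iff it is differentiable and
  all of its directional derivatives are of class C^k.
\<close>

primrec C_k_on :: "nat \<Rightarrow> ('a::real_normed_vector \<Rightarrow> 'b::real_normed_vector) \<Rightarrow> 'a set \<Rightarrow> bool"
  where
    "C_k_on 0 f S \<longleftrightarrow> continuous_on S f"
  | "C_k_on (Suc k) f S \<longleftrightarrow>
       (\<forall>x\<in>S. f differentiable (at x)) \<and>
       (\<forall>v. C_k_on k (\<lambda>x. frechet_derivative f (at x) v) S)"

definition smooth_on :: "('a::real_normed_vector \<Rightarrow> 'b::real_normed_vector) \<Rightarrow> 'a set \<Rightarrow> bool"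
  where "smooth_on f S \<longleftrightarrow> (\<forall>k. C_k_on k f S)"

definition chart :: "'a topology \<Rightarrow> 'a set \<Rightarrow> ('a \<Rightarrow> real^'n) \<Rightarrow> bool"
  where "chart X W \<phi> \<longleftrightarrow>
    openin X W \<and> open (\<phi> ` W) \<and>
    homeomorphic_map (subtopology X W) (top_of_set (\<phi> ` W)) \<phi>"

text \<open>
  A smooth manifold without boundary of dimension \<open>CARD('n)\<close>, given by its underlying Hausdorff,
  second countable space together with a smooth atlas, which need not be maximal.
\<close>

definition smooth_manifold :: "'a topology \<Rightarrow> ('a set \<times> ('a \<Rightarrow> real^'n)) set \<Rightarrow> bool"
  where "smooth_manifold X \<A> \<longleftrightarrow>
    Hausdorff_space X \<and> second_countable X \<and>
    (\<forall>(W, \<phi>)\<in>\<A>. chart X W \<phi>) \<and>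
    (\<Union>(W, \<phi>)\<in>\<A>. W) = topspace X \<and>
    (\<forall>(V, \<phi>)\<in>\<A>. \<forall>(W, \<psi>)\<in>\<A>. smooth_on (\<psi> \<circ> inv_into V \<phi>) (\<phi> ` (V \<inter> W)))"

text \<open>
  Smoothness of a map from a manifold into (an open subset of) a Euclidean space, the latter
  carrying its standard smooth structure. Continuity need not be required separately, since the
  chart domains cover the manifold.
\<close>

definition smooth_map :: "('a set \<times> ('a \<Rightarrow> real^'n)) set \<Rightarrow> ('a \<Rightarrow> real^'m) \<Rightarrow> bool"
  where "smooth_map \<A> f \<longleftrightarrow> (\<forall>(W, \<phi>)\<in>\<A>. smooth_on (f \<circ> inv_into W \<phi>) (\<phi> ` W))"

definition linear_perturbation :: "('a \<Rightarrow> 'b) \<Rightarrow> ('a \<Rightarrow> 'b) \<Rightarrow> 'a \<Rightarrow> 'b::plus"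
  where "linear_perturbation F \<pi> = (\<lambda>x. F x + \<pi> x)"

end

theory Submission
  imports Defs
begin

text \<open>
  As \<open>f\<close> is injective, only pairs of distinct points of its image can be identified wrongly.
  Two distinct points \<open>x\<close>, \<open>y\<close> of the image of \<open>f\<close> are identified by \<open>F + A\<close> exactly if the matrix
  \<open>A\<close> solves \<open>A (x - y) = F y - F x\<close>. Since \<open>x - y\<close> is nonzero, this is a system of \<open>l\<close> independent
  linear equations in the entries of \<open>A\<close>, so its solutions form an affine subspace of codimension
  \<open>l\<close>. The pairs \<open>(x, y)\<close> move in a family with \<open>2n < l\<close> parameters, which leaves the union of
  all these subspaces at codimension at least \<open>l - 2n > 0\<close>; it is therefore a null set.

  The dimension count is made rigorous in \<open>negligible_matrices_solving\<close>: a differentiable family of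
  nontrivial systems \<open>A u(z) = v(z)\<close> with fewer than \<open>l\<close> real parameters has a negligible set of
  solutions. Where a fixed component \<open>u\<^sub>j\<close> is nonzero, the \<open>j\<close>th column of a solution is determined
  by \<open>z\<close> and the other columns. The solutions are thus a differentiable image of a set of pairs
  (\<open>z\<close>, other columns), and this set can be placed inside the space of matrices itself, with \<open>z\<close>
  encoded in the now redundant \<open>j\<close>th column. As \<open>z\<close> has fewer than \<open>l\<close> coordinates, the encoding
  uses only a hyperplane of that column space, and differentiable maps take negligible sets to
  negligible sets.

  On the manifold, second countability gives a countable atlas, and the bad matrices are covered by
  the countably many sets belonging to pairs of charts; there the parameter is the pair of
  coordinate vectors of the two points.
\<close>


lemma differentiable_matrixI:
  fixes G :: "'p::real_normed_vector \<Rightarrow> real^'m^'l"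
  assumes "\<And>i k. (\<lambda>x. G x $ i $ k) differentiable (at a within S)"
  shows "G differentiable (at a within S)"
  unfolding differentiable_componentwise_within[of G]
  using assms by (auto simp: Basis_vec_def inner_axis)

lemma differentiable_vec_nth:
  fixes g :: "'p::real_normed_vector \<Rightarrow> 'a::real_normed_vector^'m"
  assumes "g differentiable (at a within S)"
  shows "(\<lambda>x. g x $ k) differentiable (at a within S)"
  using differentiable_compose[of "\<lambda>v. v $ k" g a S] assms
    bounded_linear_imp_differentiable[OF bounded_linear_vec_nth] by blast

text \<open>
  A nontrivial linear condition on one column is a nontrivial linear condition on the whole matrix:
  its normal is the matrix with that column \<open>c\<close> and zeros elsewhere.
\<close>

lemma negligible_column_hyperplane:
  fixes c :: "real^'l" and j :: "'m::finite"
  assumes "c \<noteq> 0"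
  shows "negligible {A :: real^'m^'l. c \<bullet> column j A = 0}"
proof -
  define w :: "real^'m^'l" where "w = (\<chi> i. axis j (c $ i))"
  have "w \<noteq> 0"
    using assms by (auto simp: w_def vec_eq_iff axis_def)
  moreover have "w \<bullet> A = c \<bullet> column j A" for A
    unfolding inner_vec_def[of w] inner_vec_def[of c]
    by (simp add: w_def inner_axis' column_def)
  ultimately show ?thesis
    using negligible_hyperplane[of w 0] by simp
qed

text \<open>
  With \<open>u\<^sub>j \<noteq> 0\<close> the equations can be solved for the \<open>j\<close>th column of the matrix. That column is
  then free to carry the parameter \<open>z\<close> instead, linearly encoded in a proper subspace. The map \<open>G\<close>
  decodes \<open>z\<close> and corrects the column so that \<open>G A\<close> solves the system for \<open>z\<close>; the set in
  question is covered by the image under \<open>G\<close> of the negligible set \<open>S\<close> of encodings.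
\<close>

lemma negligible_matrices_solving_nonzero_component:
  fixes u :: "'p::euclidean_space \<Rightarrow> real^'m" and v :: "'p \<Rightarrow> real^'l" and j :: "'m::finite"
  assumes dim: "DIM('p) < CARD('l)"
    and u: "u differentiable_on Z" and v: "v differentiable_on Z"
    and nz: "\<And>z. z \<in> Z \<Longrightarrow> u z $ j \<noteq> 0"
  shows "negligible {A :: real^'m^'l. \<exists>z\<in>Z. A *v u z = v z}"
proof -
  obtain T :: "(real^'l) set" where T: "subspace T" "dim T = DIM('p)"
    using choose_subspace_of_subspace[of "DIM('p)" "UNIV :: (real^'l) set"] dim
    by (auto simp: dim_UNIV)
  obtain e :: "'p \<Rightarrow> real^'l" and L where L: "linear L" and eT: "range e = T"
    and Le: "\<And>z. L (e z) = z"
    using isometries_subspaces[of "UNIV :: 'p set" T] T by (metis UNIV_I dim_UNIV subspace_UNIV)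
  obtain c where c: "c \<noteq> 0" "T \<subseteq> {x. c \<bullet> x = 0}"
    using lowdim_subset_hyperplane[of T] T dim span_superset[of T] by auto
  define \<zeta> :: "real^'m^'l \<Rightarrow> 'p" where "\<zeta> A = L (column j A)" for A
  (* The residual v - A u, divided by the pivot, is added to column j: a column change d alters A u
     by d times the pivot. In this form column j need not be separated out of the product A u. *)
  define G :: "real^'m^'l \<Rightarrow> real^'m^'l" where
    "G A = (\<chi> i k. A $ i $ k +
       (if k = j then (v (\<zeta> A) $ i - (\<Sum>h\<in>UNIV. A $ i $ h * u (\<zeta> A) $ h)) / u (\<zeta> A) $ j else 0))" for A
  define S where "S = {A :: real^'m^'l. c \<bullet> column j A = 0 \<and> \<zeta> A \<in> Z}"
  have "linear \<zeta>"
    unfolding \<zeta>_def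
    by (intro linear_compose[OF _ L, unfolded o_def] linearI)
       (auto simp: column_def vec_eq_iff)
  then have \<zeta>: "\<zeta> differentiable (at A within S)" for A
    by (simp add: linear_imp_differentiable)
  have \<zeta>S: "\<zeta> ` S \<subseteq> Z"
    by (auto simp: S_def)
  have "G differentiable (at A within S)" if A: "A \<in> S" for A
  proof (rule differentiable_matrixI)
    fix i k
    have comp: "(\<lambda>A. g (\<zeta> A)) differentiable (at A within S)"
      if "g differentiable_on Z" for g :: "'p \<Rightarrow> 'c::real_normed_vector"
    proof -
      have "g differentiable (at (\<zeta> A) within \<zeta> ` S)"
        using that A \<zeta>S by (meson differentiable_on_def differentiable_on_subset image_eqI)
      from differentiable_chain_within[OF \<zeta> this] show ?thesis
        by (simp add: o_def)
    qed
    have "u (\<zeta> A) $ j \<noteq> 0"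
      using A nz by (auto simp: S_def)
    moreover have "(\<lambda>A. A $ i $ h) differentiable (at A within S)" for h
      by (intro differentiable_vec_nth differentiable_ident)
    ultimately show "(\<lambda>A. G A $ i $ k) differentiable (at A within S)"
      unfolding G_def
      by (cases "k = j")
        (auto intro!: differentiable_add differentiable_diff differentiable_divide differentiable_sum
         differentiable_mult differentiable_vec_nth[OF comp[OF u]] differentiable_vec_nth[OF comp[OF v]])
  qed
  then have "G differentiable_on S"
    by (simp add: differentiable_on_def)
  moreover have "negligible S"
    by (rule negligible_subset[OF negligible_column_hyperplane[OF c(1), of j]])
      (auto simp: S_def)
  ultimately have "negligible (G ` S)"
    by (intro negligible_differentiable_image_negligible) auto
  (* A solution B for z is recovered from the encoding A that overwrites column j of B by e z. *)
  moreover have "B \<in> G ` S" if z: "z \<in> Z" and B: "B *v u z = v z" for B z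
  proof
    define A :: "real^'m^'l" where "A = (\<chi> i k. if k = j then e z $ i else B $ i $ k)"
    have col: "column j A = e z"
      by (simp add: A_def column_def vec_eq_iff)
    then have \<zeta>A: "\<zeta> A = z"
      by (simp add: \<zeta>_def Le)
    show "A \<in> S"
      using c(2) eT z col \<zeta>A by (auto simp: S_def)
    have "(\<Sum>h\<in>UNIV. A $ i $ h * u z $ h) = v z $ i + (A $ i $ j - B $ i $ j) * u z $ j" for i
    proof -
      have "(\<Sum>h\<in>UNIV. A $ i $ h * u z $ h) - v z $ i
          = (\<Sum>h\<in>UNIV. A $ i $ h * u z $ h - B $ i $ h * u z $ h)"
        by (simp add: B[symmetric] matrix_vector_mult_def sum_subtractf)
      also have "\<dots> = (\<Sum>h\<in>UNIV. if h = j then (A $ i $ j - B $ i $ j) * u z $ j else 0)"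
        by (intro sum.cong) (auto simp: A_def algebra_simps)
      finally show ?thesis
        by simp
    qed
    then show "B = G A"
      using nz[OF z] by (auto simp: G_def \<zeta>A vec_eq_iff) (simp add: A_def)
  qed
  ultimately show ?thesis
    by (auto intro: negligible_subset)
qed

text \<open>
  A nonzero vector has some nonzero component, and there are finitely many components to choose as
  the pivot. Differentiability is meant within \<open>Z\<close>, an arbitrary set, so it passes to the piece of
  \<open>Z\<close> that belongs to each pivot.
\<close>

lemma negligible_matrices_solving:
  fixes u :: "'p::euclidean_space \<Rightarrow> real^'m" and v :: "'p \<Rightarrow> real^'l"
  assumes dim: "DIM('p) < CARD('l)"
    and u: "u differentiable_on Z" and v: "v differentiable_on Z"
    and nz: "\<And>z. z \<in> Z \<Longrightarrow> u z \<noteq> 0"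
  shows "negligible {A :: real^'m^'l. \<exists>z\<in>Z. A *v u z = v z}"
proof -
  define Z' where "Z' j = {z \<in> Z. u z $ j \<noteq> 0}" for j
  have "negligible {A :: real^'m^'l. \<exists>z\<in>Z' j. A *v u z = v z}" for j
    by (rule negligible_matrices_solving_nonzero_component[OF dim, where j = j])
      (auto simp: Z'_def intro: differentiable_on_subset[OF u] differentiable_on_subset[OF v])
  then have "negligible (\<Union>j. {A :: real^'m^'l. \<exists>z\<in>Z' j. A *v u z = v z})"
    by (intro negligible_Union) auto
  moreover have "z \<in> (\<Union>j. Z' j)" if "z \<in> Z" for z
    using nz[OF that] that by (auto simp: Z'_def vec_eq_iff)
  ultimately show ?thesis
    by (elim negligible_subset) blast
qed

lemma smooth_on_imp_differentiable:
  assumes "smooth_on f S" "x \<in> S"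
  shows "f differentiable (at x)"
  using assms unfolding smooth_on_def by (metis C_k_on.simps(2))

text \<open>
  The instance for a pair of parametrisations: the parameter \<open>z = (s, t)\<close> ranges over a space of
  dimension \<open>2n\<close>, and \<open>u(z) = g s - h t\<close>, \<open>v(z) = F (h t) - F (g s)\<close>. The diagonal is removed through
  the condition \<open>g s \<noteq> h t\<close>, so the two charts may overlap or coincide.
\<close>

lemma negligible_matrices_identifying_chart_points:
  fixes g h :: "real^'n \<Rightarrow> real^'m" and F :: "real^'m \<Rightarrow> real^'l"
  assumes dim: "CARD('l) > 2 * CARD('n)"
    and g: "\<And>s. s \<in> D \<Longrightarrow> g differentiable (at s)" "g ` D \<subseteq> U"
    and h: "\<And>t. t \<in> E \<Longrightarrow> h differentiable (at t)" "h ` E \<subseteq> U"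
    and F: "\<And>x. x \<in> U \<Longrightarrow> F differentiable (at x)"
  shows "negligible {A :: real^'m^'l. \<exists>s\<in>D. \<exists>t\<in>E. g s \<noteq> h t \<and>
           F (g s) + A *v g s = F (h t) + A *v h t}"
proof -
  define Z where "Z = {(s, t). s \<in> D \<and> t \<in> E \<and> g s \<noteq> h t}"
  have fst: "fst differentiable (at z)" and snd: "snd differentiable (at z)"
    for z :: "(real^'n) \<times> (real^'n)"
    by (simp_all add: linear_imp_differentiable linear_fst linear_snd)
  have gfst: "(\<lambda>z. g (fst z)) differentiable (at z)"
    and hsnd: "(\<lambda>z. h (snd z)) differentiable (at z)" if "z \<in> Z" for z
    using that differentiable_chain_at[OF fst g(1)] differentiable_chain_at[OF snd h(1)]
    by (auto simp: Z_def o_def)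
  moreover have "(\<lambda>z. F (g (fst z))) differentiable (at z)"
    and "(\<lambda>z. F (h (snd z))) differentiable (at z)" if "z \<in> Z" for z
  proof -
    have "g (fst z) \<in> U" "h (snd z) \<in> U"
      using that g(2) h(2) by (auto simp: Z_def)
    then show "(\<lambda>z. F (g (fst z))) differentiable (at z)"
      and "(\<lambda>z. F (h (snd z))) differentiable (at z)"
      using differentiable_chain_at[OF gfst[OF that] F] differentiable_chain_at[OF hsnd[OF that] F]
      by (simp_all add: o_def)
  qed
  ultimately have "negligible {A :: real^'m^'l. \<exists>z\<in>Z.
      A *v (g (fst z) - h (snd z)) = F (h (snd z)) - F (g (fst z))}"
    using dim
    by (intro negligible_matrices_solving differentiable_at_imp_differentiable_on differentiable_diff)
      (auto simp: Z_def)
  then show ?thesis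
    by (rule negligible_subset)
      (auto simp: Z_def matrix_vector_mult_diff_distrib algebra_simps intro!: bexI[of _ "(s, t)" for s t])
qed

lemma smooth_manifold_countable_atlas:
  assumes "smooth_manifold X \<A>"
  obtains \<C> where "countable \<C>" "\<C> \<subseteq> \<A>" "(\<Union>(W, \<phi>)\<in>\<C>. W) = topspace X"
proof -
  have "Lindelof_space X"
    using assms by (simp add: smooth_manifold_def second_countable_imp_Lindelof_space)
  moreover have "\<And>W. W \<in> fst ` \<A> \<Longrightarrow> openin X W" "\<Union>(fst ` \<A>) = topspace X"
    using assms by (auto simp: smooth_manifold_def chart_def split_beta)
  ultimately obtain \<V> where "countable \<V>" "\<V> \<subseteq> fst ` \<A>" "\<Union>\<V> = topspace X"
    by (meson Lindelof_spaceD)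
  then show thesis
    using that by (metis (no_types, lifting) SUP_cong countable_subset_image split_beta)
qed

lemma chart_inverse:
  assumes "chart X W \<phi>" "p \<in> W"
  shows "inv_into W \<phi> (\<phi> p) = p"
proof -
  have "topspace (subtopology X W) = W"
    using assms by (auto simp: chart_def dest: openin_subset)
  then have "inj_on \<phi> W"
    using assms homeomorphic_imp_injective_map unfolding chart_def by metis
  then show ?thesis
    using assms(2) by simp
qed

theorem corollary5:
  fixes X :: "'a topology"
    and \<A> :: "('a set \<times> ('a \<Rightarrow> real^'n)) set"
    and f :: "'a \<Rightarrow> real^'m"
    and U :: "(real^'m) set"
    and F :: "real^'m \<Rightarrow> real^'l"
  assumes "smooth_manifold X \<A>"
    and "open U"
    and "smooth_map \<A> f"
    and "f ` topspace X \<subseteq> U"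
    and "inj_on f (topspace X)"
    and "smooth_on F U"
    and "CARD('l) > 2 * CARD('n)"
  shows "\<exists>\<Sigma> \<subseteq> {\<pi> :: real^'m \<Rightarrow> real^'l. linear \<pi>}.
           matrix ` \<Sigma> \<in> null_sets lebesgue \<and>
           (\<forall>\<pi> \<in> {\<pi>. linear \<pi>} - \<Sigma>.
              inj_on (linear_perturbation F \<pi> \<circ> f) (topspace X))"
proof -
  obtain \<C> where \<C>: "countable \<C>" "\<C> \<subseteq> \<A>" "(\<Union>(W, \<phi>)\<in>\<C>. W) = topspace X"
    using smooth_manifold_countable_atlas[OF assms(1)] .
  have chart: "chart X W \<phi>" and W: "W \<subseteq> topspace X"
    and f: "smooth_on (f \<circ> inv_into W \<phi>) (\<phi> ` W)" if "(W, \<phi>) \<in> \<C>" for W \<phi>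
  proof -
    have "(W, \<phi>) \<in> \<A>"
      using that \<C>(2) by auto
    moreover have "\<forall>(W, \<phi>)\<in>\<A>. chart X W \<phi>"
      using assms(1) by (simp add: smooth_manifold_def)
    ultimately show "chart X W \<phi>" "smooth_on (f \<circ> inv_into W \<phi>) (\<phi> ` W)"
      using assms(3) by (auto simp: smooth_map_def)
    then show "W \<subseteq> topspace X"
      by (simp add: chart_def openin_subset)
  qed
  define g where "g = (\<lambda>(W, \<phi>). f \<circ> inv_into W (\<phi> :: 'a \<Rightarrow> real^'n))"
  define D where "D = (\<lambda>(W, \<phi>). (\<phi> :: 'a \<Rightarrow> real^'n) ` W)"
  define B :: "_ \<Rightarrow> _ \<Rightarrow> (real^'m^'l) set" where
    "B \<alpha> \<beta> = {A. \<exists>s\<in>D \<alpha>. \<exists>t\<in>D \<beta>. g \<alpha> s \<noteq> g \<beta> t \<and>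
       F (g \<alpha> s) + A *v g \<alpha> s = F (g \<beta> t) + A *v g \<beta> t}" for \<alpha> \<beta>
  have g_diff: "g \<alpha> differentiable (at s)" if "\<alpha> \<in> \<C>" "s \<in> D \<alpha>" for \<alpha> s
  proof (rule smooth_on_imp_differentiable)
    show "smooth_on (g \<alpha>) (D \<alpha>)"
      using f[of "fst \<alpha>" "snd \<alpha>"] that(1) by (simp add: g_def D_def split_beta)
  qed (use that in simp)
  have g_chart: "g (W, \<phi>) (\<phi> p) = f p" if "(W, \<phi>) \<in> \<C>" "p \<in> W" for W \<phi> p
    using chart_inverse[OF chart[OF that(1)] that(2)] by (simp add: g_def)
  have gU: "g \<alpha> ` D \<alpha> \<subseteq> U" if "\<alpha> \<in> \<C>" for \<alpha>
    using that g_chart W assms(4) by (cases \<alpha>) (fastforce simp: D_def)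
  have "negligible (B \<alpha> \<beta>)" if "\<alpha> \<in> \<C>" "\<beta> \<in> \<C>" for \<alpha> \<beta>
    unfolding B_def using that assms(6,7)
    by (intro negligible_matrices_identifying_chart_points[where U = U] g_diff gU
        smooth_on_imp_differentiable[of F U])
  then have "negligible (\<Union>(\<alpha>, \<beta>)\<in>\<C> \<times> \<C>. B \<alpha> \<beta>)"
    using \<C>(1) by (intro negligible_countable_Union) auto
  moreover define \<Sigma> where "\<Sigma> = {\<pi>. linear \<pi> \<and> matrix \<pi> \<in> (\<Union>(\<alpha>, \<beta>)\<in>\<C> \<times> \<C>. B \<alpha> \<beta>)}"
  ultimately have "negligible (matrix ` \<Sigma>)"
    by (elim negligible_subset) auto
  moreover have "inj_on (linear_perturbation F \<pi> \<circ> f) (topspace X)"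
    if \<pi>: "linear \<pi>" "\<pi> \<notin> \<Sigma>" for \<pi>
  proof (rule inj_onI, rule ccontr)
    fix p q
    assume p: "p \<in> topspace X" and q: "q \<in> topspace X" and "p \<noteq> q"
      and eq: "(linear_perturbation F \<pi> \<circ> f) p = (linear_perturbation F \<pi> \<circ> f) q"
    have "f p \<noteq> f q"
      using \<open>p \<noteq> q\<close> p q assms(5) by (auto dest: inj_onD)
    obtain W \<phi> V \<psi> where \<alpha>: "(W, \<phi>) \<in> \<C>" "p \<in> W" and \<beta>: "(V, \<psi>) \<in> \<C>" "q \<in> V"
      using p q \<C>(3) by blast
    have "\<phi> p \<in> D (W, \<phi>)" "\<psi> q \<in> D (V, \<psi>)"
      using \<alpha> \<beta> by (auto simp: D_def)
    moreover have "F (f p) + matrix \<pi> *v f p = F (f q) + matrix \<pi> *v f q"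
      using eq by (simp add: linear_perturbation_def matrix_works \<pi>(1) linear_matrix_vector_mul_eq)
    ultimately have "matrix \<pi> \<in> B (W, \<phi>) (V, \<psi>)"
      unfolding B_def using \<open>f p \<noteq> f q\<close> g_chart[OF \<alpha>] g_chart[OF \<beta>] by force
    then show False
      using \<pi> \<alpha>(1) \<beta>(1) by (auto simp: \<Sigma>_def)
  qed
  ultimately show ?thesis
    by (intro exI[of _ \<Sigma>]) (auto simp: \<Sigma>_def negligible_iff_null_sets)
qed

end
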